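(* Let $G$ be a graph and $f$ an arithmetic IASI of $G$ such that $|f(v)|=l$ for every vertex $v\in V(G)$. Then $f$ is an isoarithmetic IASI of $G$ if and only if $|f^+(e)|=2l-1$ for every edge $e\in E(G)$ (i.e. $f$ is a $(2l-1)$-uniform IASI).
   Context: All graphs are simple and finite with no isolated vertices. Let $\mathbb{N}_0$ be the set of non-negative integers and $\mathcal{P}(\mathbb{N}_0)$ its power set; all label sets are finite and non-empty. For sets $A,B$, $A+B=\{a+b: a\in A, b\in B\}$. An integer additive set-indexer (IASI) of $G$ is an injective map $f:V(G)\to\mathcal{P}(\mathbb{N}_0)$ such that the induced map $f^+:E(G)\to\mathcal{P}(\mathbb{N}_0)$, $f^+(uv)=f(u)+f(v)$, is also injective. An IASI is $k$-uniform if $|f^+(e)|=k$ for all edges $e$. An AP-set is a finite set of integers with at least three elements forming an arithmetic progression; its common difference is the deterministic index of the element it labels. An IASI $f$ is arithmetic if $f(v)$ is an AP-set for every vertex $v$ and $f^+(e)$ is an AP-set for every edge $e$. An arithmetic IASI is isoarithmetic if all vertices and edges of $G$ have the same deterministic index.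
   Formalization: The direction from (2l−1)-uniform to isoarithmetic is proved only for connected G, since it fails for two disjoint edges labelled {0,1,2},{1,2,3} and {0,2,4},{2,4,6}; the direction from isoarithmetic to (2l−1)-uniform is proved for all graphs. *)

theory Defs
  imports Main "HOL-Library.Set_Algebras"
begin

text \<open>
  A finite simple graph without isolated vertices, given by its vertex set and its set of
  edges, an edge being the two-element set of its ends.
\<close>

definition simple_graph :: "'a set \<Rightarrow> 'a set set \<Rightarrow> bool" where
  "simple_graph V E \<longleftrightarrow>
     finite V \<and>
     (\<forall>e\<in>E. e \<subseteq> V \<and> card e = 2) \<and>
     (\<forall>v\<in>V. \<exists>e\<in>E. v \<in> e)"

definition connected_graph :: "'a set \<Rightarrow> 'a set set \<Rightarrow> bool" where
  "connected_graph V E \<longleftrightarrow> (\<forall>u\<in>V. \<forall>v\<in>V. (u, v) \<in> {(x, y). {x, y} \<in> E}\<^sup>*)"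

text \<open>
  The induced edge labelling \<open>f\<^sup>+\<close>.  The sum is the one of \<^theory>\<open>HOL-Library.Set_Algebras\<close>, i.e. it
  is formed with elementwise addition of sets; since an edge has exactly two ends, it is the
  sumset of their labels (lemma \<open>edge_label_doubleton\<close>).
\<close>

definition edge_label :: "('a \<Rightarrow> nat set) \<Rightarrow> 'a set \<Rightarrow> nat set" where
  "edge_label f e = (\<Sum>v\<in>e. f v)"

lemma edge_label_doubleton:
  assumes "u \<noteq> v"
  shows "edge_label f {u, v} = {a + b | a b. a \<in> f u \<and> b \<in> f v}"
  using assms by (auto simp: edge_label_def set_plus_def)

definition IASI :: "'a set \<Rightarrow> 'a set set \<Rightarrow> ('a \<Rightarrow> nat set) \<Rightarrow> bool" where
  "IASI V E f \<longleftrightarrow>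
     (\<forall>v\<in>V. finite (f v) \<and> f v \<noteq> {}) \<and> inj_on f V \<and> inj_on (edge_label f) E"

definition uniform_IASI :: "nat \<Rightarrow> 'a set \<Rightarrow> 'a set set \<Rightarrow> ('a \<Rightarrow> nat set) \<Rightarrow> bool" where
  "uniform_IASI k V E f \<longleftrightarrow> IASI V E f \<and> (\<forall>e\<in>E. card (edge_label f e) = k)"

text \<open>
  Common differences are normalised to be positive; this makes the common difference of an
  AP-set unique (lemma \<open>AP_diff_unique\<close>).
\<close>

definition AP_with_diff :: "nat \<Rightarrow> nat set \<Rightarrow> bool" where
  "AP_with_diff d A \<longleftrightarrow> d > 0 \<and> (\<exists>a n. n \<ge> 3 \<and> A = {a + i * d | i. i < n})"

definition AP_set :: "nat set \<Rightarrow> bool" where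
  "AP_set A \<longleftrightarrow> (\<exists>d. AP_with_diff d A)"

definition det_index :: "nat set \<Rightarrow> nat" where
  "det_index A = (THE d. AP_with_diff d A)"

lemma AP_diff_le:
  assumes "AP_with_diff d A" "AP_with_diff d' A"
  shows "d' \<le> d"
proof -
  obtain a n where A: "n \<ge> 3" "d > 0" "A = {a + i * d | i. i < n}"
    using assms(1) unfolding AP_with_diff_def by auto
  obtain b m where B: "m \<ge> 3" "d' > 0" "A = {b + i * d' | i. i < m}"
    using assms(2) unfolding AP_with_diff_def by auto
  have "0 < n" "1 < n" using A(1) by auto
  then have "a + 0 * d \<in> A" "a + 1 * d \<in> A" unfolding A(3) by blast+
  then have "a \<in> A" "a + d \<in> A" by simp_all
  then obtain i j where ij: "a = b + i * d'" "a + d = b + j * d'"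
    unfolding B(3) by blast
  have "i * d' < j * d'" using ij A(2) by linarith
  then have "i < j" by simp
  then obtain k where "j = i + Suc k" using less_imp_Suc_add by auto
  then have "d = Suc k * d'" using ij by (simp add: algebra_simps)
  then show ?thesis by simp
qed

lemma AP_diff_unique: "AP_with_diff d A \<Longrightarrow> AP_with_diff d' A \<Longrightarrow> d = d'"
  using AP_diff_le[of d A d'] AP_diff_le[of d' A d] by simp

lemma det_index_eq: "AP_with_diff d A \<Longrightarrow> det_index A = d"
  unfolding det_index_def using AP_diff_unique by blast

definition arithmetic_IASI :: "'a set \<Rightarrow> 'a set set \<Rightarrow> ('a \<Rightarrow> nat set) \<Rightarrow> bool" where
  "arithmetic_IASI V E f \<longleftrightarrow>
     IASI V E f \<and> (\<forall>v\<in>V. AP_set (f v)) \<and> (\<forall>e\<in>E. AP_set (edge_label f e))"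

definition isoarithmetic_IASI :: "'a set \<Rightarrow> 'a set set \<Rightarrow> ('a \<Rightarrow> nat set) \<Rightarrow> bool" where
  "isoarithmetic_IASI V E f \<longleftrightarrow>
     arithmetic_IASI V E f \<and>
     (\<exists>d. (\<forall>v\<in>V. det_index (f v) = d) \<and> (\<forall>e\<in>E. det_index (edge_label f e) = d))"

text \<open>
  A uniform arithmetic IASI of a disconnected graph may have different deterministic indices
  on different components.  For example, on two disjoint edges \<open>ab\<close> and \<open>cd\<close> put
  \<open>f(a) = {0,1,2}\<close>, \<open>f(b) = {1,2,3}\<close>, \<open>f(c) = {0,2,4}\<close>, \<open>f(d) = {2,4,6}\<close>: this is a 5-uniform
  arithmetic IASI with all vertex labels of size 3, but its indices are 1 and 2.  Hence
  (2l-1)-uniformity implies isoarithmetic only for connected graphs, whereas the converse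
  implication holds for all graphs.
\<close>

end

theory Submission
  imports Defs
begin

text \<open>
  Two progressions of lengths \<open>m\<close> and \<open>n\<close> with the same difference have a sumset that is again a
  progression with this difference, of length \<open>m + n - 1\<close>.  If the differences are \<open>d < e\<close>, then
  walking first along the \<open>e\<close>-progression and then along the \<open>d\<close>-progression gives \<open>m + n - 1\<close>
  distinct sums, and the sum one \<open>d\<close>-step above the minimum is missed by this walk; so there are
  at least \<open>m + n\<close> sums.  Hence uniformity forces the same index at the two ends of every edge,
  and connectivity makes the index global.
\<close>

lemma card_AP:
  fixes a d n :: nat
  assumes "d > 0"
  shows "card {a + i * d | i. i < n} = n"
proof -
  have "{a + i * d | i. i < n} = (\<lambda>i. a + i * d) ` {..<n}" by auto
  moreover have "inj_on (\<lambda>i. a + i * d) {..<n}" using assms by (auto simp: inj_on_def)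
  ultimately show ?thesis by (simp add: card_image)
qed

text \<open>The length of a progression with positive difference is its cardinality, so sizes of
  label sets can be used directly as lengths.\<close>

lemma AP_with_diff_cardE:
  assumes "AP_with_diff d A"
  obtains a where "d > 0" "card A \<ge> 3" "A = {a + i * d | i. i < card A}"
proof -
  obtain a n where d: "d > 0" and n: "n \<ge> 3" and A: "A = {a + i * d | i. i < n}"
    using assms unfolding AP_with_diff_def by blast
  have "card A = n" unfolding A using d by (rule card_AP)
  show thesis
  proof (rule that)
    show "d > 0" by (fact d)
    show "card A \<ge> 3" unfolding \<open>card A = n\<close> by (fact n)
    show "A = {a + i * d | i. i < card A}" unfolding \<open>card A = n\<close> by (fact A)
  qed
qed

lemma AP_sumset_same_diff:
  fixes a b d m n :: nat
  assumes "m > 0" "n > 0"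
  shows "{a + i * d | i. i < m} + {b + j * d | j. j < n} = {(a + b) + k * d | k. k < m + n - 1}"
    (is "?L = ?R")
proof
  show "?L \<subseteq> ?R"
  proof
    fix x assume "x \<in> ?L"
    then obtain i j where "i < m" "j < n" "x = (a + i * d) + (b + j * d)"
      by (auto simp: set_plus_def)
    then have "i + j < m + n - 1" "x = (a + b) + (i + j) * d" by (auto simp: algebra_simps)
    then show "x \<in> ?R" by blast
  qed
  show "?R \<subseteq> ?L"
  proof
    fix x assume "x \<in> ?R"
    then obtain k where k: "k < m + n - 1" "x = (a + b) + k * d" by blast
    \<comment> \<open>Greedy split of \<open>k\<close>: exhaust the \<open>m - 1\<close> steps of
      the first progression, then take the remaining steps, fewer than \<open>n\<close>, in the
      second.\<close>
    define i where "i = min k (m - 1)"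
    have "i < m" "k - i < n" "k = i + (k - i)"
      using k(1) assms by (auto simp: i_def)
    moreover have "k * d = i * d + (k - i) * d"
      by (simp add: i_def flip: add_mult_distrib)
    then have "x = (a + i * d) + (b + (k - i) * d)" using k(2) by simp
    ultimately show "x \<in> ?L" by blast
  qed
qed

lemma card_AP_sumset_diff_less:
  fixes a b d e m n :: nat
  assumes "0 < d" "d < e" "m \<ge> 2" "n \<ge> 2"
  shows "m + n \<le> card ({a + i * d | i. i < m} + {b + j * e | j. j < n})" (is "_ \<le> card ?S")
proof -
  \<comment> \<open>\<open>?P\<close> climbs from the minimum by \<open>e\<close>-steps.
    \<open>?Q\<close> continues from the top of \<open>?P\<close> by \<open>d\<close>-steps; it
    starts one step later to stay disjoint from \<open>?P\<close>, hence the \<open>m - 1\<close>.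
    \<open>?w\<close> is the sum missed by both.\<close>
  let ?P = "{(a + b) + j * e | j. j < n}"
  let ?Q = "{(a + b + (n - 1) * e + d) + i * d | i. i < m - 1}"
  let ?w = "a + b + d"
  have S: "(a + i * d) + (b + j * e) \<in> ?S" if "i < m" "j < n" for i j
    using that by blast
  have "?P \<subseteq> ?S"
  proof
    fix x assume "x \<in> ?P"
    then obtain j where "j < n" "x = (a + b) + j * e" by blast
    then show "x \<in> ?S" using S[of 0 j] assms(3) by (simp add: add.assoc)
  qed
  moreover have "?Q \<subseteq> ?S"
  proof
    fix x assume "x \<in> ?Q"
    then obtain i where "i < m - 1" "x = (a + b + (n - 1) * e + d) + i * d" by blast
    then show "x \<in> ?S" using S[of "Suc i" "n - 1"] assms(4) by (simp add: algebra_simps)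
  qed
  moreover have "?w \<in> ?S" using S[of 1 0] assms(3,4) by (simp add: algebra_simps)
  ultimately have "insert ?w (?P \<union> ?Q) \<subseteq> ?S"
    by (simp only: insert_subset Un_subset_iff simp_thms)
  moreover have "finite ?S" by (rule finite_set_plus) simp_all
  ultimately have le: "card (insert ?w (?P \<union> ?Q)) \<le> card ?S"
    by (rule card_mono[rotated])
  have P_le: "x \<le> a + b + (n - 1) * e" if "x \<in> ?P" for x
  proof -
    obtain j where j: "j < n" "x = (a + b) + j * e" using \<open>x \<in> ?P\<close> by blast
    then have "j * e \<le> (n - 1) * e" by (intro mult_right_mono) auto
    then show ?thesis using j by simp
  qed
  have disj: "?P \<inter> ?Q = {}"
  proof (intro equals0I, elim IntE)
    fix x assume "x \<in> ?P" "x \<in> ?Q"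
    then have "x \<le> a + b + (n - 1) * e" "a + b + (n - 1) * e + d \<le> x"
      using P_le[of x] by auto
    then show False using assms(1) by simp
  qed
  \<comment> \<open>Since \<open>0 < d < e\<close>, \<open>?w\<close> lies strictly between the
    first two elements of \<open>?P\<close>.\<close>
  have wP: "?w \<notin> ?P"
  proof
    assume "?w \<in> ?P"
    then obtain j where "d = j * e" by auto
    then show False using assms(1,2) by (cases j) auto
  qed
  \<comment> \<open>The least possible element of \<open>?Q\<close> exceeds \<open>?w\<close> by
    \<open>(n - 1) * e\<close>, which is positive because \<open>n \<ge> 2\<close>.\<close>
  have wQ: "?w \<notin> ?Q"
  proof
    assume "?w \<in> ?Q"
    then have "(n - 1) * e = 0" by auto
    then show False using assms by simp
  qed
  have fin: "finite ?P" "finite ?Q" by auto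
  have "?w \<notin> ?P \<union> ?Q" using wP wQ by (simp only: Un_iff simp_thms)
  then have "card (insert ?w (?P \<union> ?Q)) = Suc (card (?P \<union> ?Q))"
    by (rule card_insert_disjoint[OF finite_UnI[OF fin]])
  also have "\<dots> = Suc (card ?P + card ?Q)"
    by (simp only: card_Un_disjoint[OF fin disj])
  also have "\<dots> = m + n"
    using assms card_AP[of e "a + b" n] card_AP[of d "a + b + (n - 1) * e + d" "m - 1"] by simp
  finally show ?thesis using le by simp
qed

lemma AP_with_diff_sumset:
  assumes "AP_with_diff d A" "AP_with_diff d B"
  shows "AP_with_diff d (A + B)" and "card (A + B) = card A + card B - 1"
proof -
  obtain a where A: "d > 0" "card A \<ge> 3" "A = {a + i * d | i. i < card A}"
    using assms(1) by (rule AP_with_diff_cardE)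
  obtain b where B: "card B \<ge> 3" "B = {b + j * d | j. j < card B}"
    using assms(2) by (rule AP_with_diff_cardE)
  have AB: "A + B = {(a + b) + k * d | k. k < card A + card B - 1}"
    using AP_sumset_same_diff[of "card A" "card B" a d b] A(2) B(1)
    unfolding A(3)[symmetric] B(2)[symmetric] by simp
  then show "card (A + B) = card A + card B - 1" using card_AP[OF A(1)] by simp
  have "card A + card B - 1 \<ge> 3" using A(2) B(1) by simp
  then show "AP_with_diff d (A + B)" unfolding AP_with_diff_def using A(1) AB by blast
qed

text \<open>Distinct differences would force at least \<open>card A + card B\<close> sums. The bound
  is stated with the smaller difference first, so the case \<open>e < d\<close> swaps the
  summands.\<close>

lemma AP_diff_eq_if_card_sumset:
  assumes "AP_with_diff d A" "AP_with_diff e B" "card (A + B) < card A + card B"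
  shows "d = e"
proof (rule ccontr)
  assume "d \<noteq> e"
  obtain a where A: "d > 0" "card A \<ge> 3" "A = {a + i * d | i. i < card A}"
    using assms(1) by (rule AP_with_diff_cardE)
  obtain b where B: "e > 0" "card B \<ge> 3" "B = {b + j * e | j. j < card B}"
    using assms(2) by (rule AP_with_diff_cardE)
  from \<open>d \<noteq> e\<close> consider "d < e" | "e < d" by linarith
  then have "card A + card B \<le> card (A + B)"
  proof cases
    case 1
    then show ?thesis
      using card_AP_sumset_diff_less[of d e "card A" "card B" a b] A(1,2) B(1,2)
      unfolding A(3)[symmetric] B(3)[symmetric] by simp
  next
    case 2
    then show ?thesis
      using card_AP_sumset_diff_less[of e d "card B" "card A" b a] A(1,2) B(1,2)
      unfolding A(3)[symmetric] B(3)[symmetric] by (simp add: add.commute)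
  qed
  then show False using assms(3) by simp
qed

lemma AP_with_diff_det_index: "AP_set A \<Longrightarrow> AP_with_diff (det_index A) A"
  unfolding AP_set_def using det_index_eq by blast

lemma edge_label_eq_set_plus: "u \<noteq> v \<Longrightarrow> edge_label f {u, v} = f u + f v"
  by (simp add: edge_label_def)

lemma simple_graph_edgeE:
  assumes "simple_graph V E" "e \<in> E"
  obtains u v where "u \<in> V" "v \<in> V" "u \<noteq> v" "e = {u, v}"
  using assms by (fastforce simp: simple_graph_def card_2_iff)

text \<open>Equality of \<open>g\<close> across edges propagates along a path by induction on the
  reflexive transitive closure.\<close>

lemma connected_graph_const:
  assumes "connected_graph V E" "u \<in> V" "v \<in> V"
    and "\<And>x y. {x, y} \<in> E \<Longrightarrow> g x = g y"
  shows "g u = g v"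
proof -
  have "(u, v) \<in> {(x, y). {x, y} \<in> E}\<^sup>*"
    using assms(1-3) by (auto simp: connected_graph_def)
  then show ?thesis by induction (use assms(4) in auto)
qed

text \<open>Both ends of an edge carry progressions of length \<open>l\<close> with one difference,
  so their sumset has \<open>l + l - 1\<close> elements.\<close>

lemma isoarithmetic_imp_uniform:
  assumes "simple_graph V E" "isoarithmetic_IASI V E f" "\<forall>v\<in>V. card (f v) = l"
  shows "uniform_IASI (2 * l - 1) V E f"
proof -
  have arith: "IASI V E f" "\<forall>v\<in>V. AP_set (f v)"
    using assms(2) by (auto simp: isoarithmetic_IASI_def arithmetic_IASI_def)
  obtain d where "\<forall>v\<in>V. det_index (f v) = d"
    using assms(2) by (auto simp: isoarithmetic_IASI_def)
  then have ap: "AP_with_diff d (f v)" if "v \<in> V" for v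
    using arith(2) that AP_with_diff_det_index by metis
  have "card (edge_label f e) = 2 * l - 1" if e: "e \<in> E" for e
  proof -
    obtain u v where uv: "u \<in> V" "v \<in> V" "u \<noteq> v" "e = {u, v}"
      using assms(1) e by (rule simple_graph_edgeE)
    show ?thesis
      using AP_with_diff_sumset(2)[OF ap ap, OF uv(1,2)] assms(3) uv
      by (simp add: edge_label_eq_set_plus mult_2)
  qed
  then show ?thesis using arith(1) by (simp add: uniform_IASI_def)
qed

text \<open>The size \<open>2 * l - 1\<close> is just below the threshold \<open>l + l\<close> for
  distinct differences, so the ends of each edge share their index. Connectivity makes it global,
  and edge labels inherit it as sumsets.\<close>

lemma uniform_imp_isoarithmetic:
  assumes "simple_graph V E" "connected_graph V E" "arithmetic_IASI V E f"
    and "\<forall>v\<in>V. card (f v) = l" "uniform_IASI (2 * l - 1) V E f"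
  shows "isoarithmetic_IASI V E f"
proof -
  have ap: "AP_with_diff (det_index (f v)) (f v)" if "v \<in> V" for v
    using assms(3) that AP_with_diff_det_index by (auto simp: arithmetic_IASI_def)
  have ends: "det_index (f u) = det_index (f v)" if "{u, v} \<in> E" for u v
  proof -
    have uv: "u \<in> V" "v \<in> V" "u \<noteq> v"
      using assms(1) that by (auto simp: simple_graph_def)
    have "card (f u + f v) = 2 * l - 1"
      using assms(5) that uv(3)
      by (metis uniform_IASI_def edge_label_eq_set_plus)
    \<comment> \<open>Subtraction on naturals truncates, so \<open>2 * l - 1 < l + l\<close> would
      fail for \<open>l = 0\<close>.\<close>
    moreover have "l > 0"
      by (rule AP_with_diff_cardE[OF ap[OF uv(1)]]) (use assms(4) uv(1) in simp)
    ultimately have "card (f u + f v) < card (f u) + card (f v)"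
      using assms(4) uv by simp
    then show ?thesis using AP_diff_eq_if_card_sumset ap uv by blast
  qed
  obtain d where d: "\<forall>v\<in>V. det_index (f v) = d"
    using connected_graph_const[OF assms(2), of _ _ "\<lambda>v. det_index (f v)"] ends by metis
  have "det_index (edge_label f e) = d" if e: "e \<in> E" for e
  proof -
    obtain u v where uv: "u \<in> V" "v \<in> V" "u \<noteq> v" "e = {u, v}"
      using assms(1) e by (rule simple_graph_edgeE)
    have "AP_with_diff d (f u + f v)"
      using AP_with_diff_sumset(1) ap[OF uv(1)] ap[OF uv(2)] d uv(1,2) by simp
    then show ?thesis using uv(3,4) by (simp add: edge_label_eq_set_plus det_index_eq)
  qed
  then show ?thesis using assms(3) d by (auto simp: isoarithmetic_IASI_def)
qed

theorem theorem2p8: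
  fixes V :: "'a set" and E :: "'a set set" and f :: "'a \<Rightarrow> nat set" and l :: nat
  assumes "simple_graph V E"
    and "arithmetic_IASI V E f"
    and "\<forall>v\<in>V. card (f v) = l"
  shows "(isoarithmetic_IASI V E f \<longrightarrow> uniform_IASI (2 * l - 1) V E f) \<and>
    (connected_graph V E \<longrightarrow>
      (isoarithmetic_IASI V E f \<longleftrightarrow> uniform_IASI (2 * l - 1) V E f))"
  using isoarithmetic_imp_uniform uniform_imp_isoarithmetic assms by blast

end
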